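(* Let $G=(V,E)$ be a finite connected graph with vertex measure $\mu:V\to(0,+\infty)$ and symmetric edge measure $w:E\to(0,+\infty)$. Let $\alpha>1$ be a real number and let $g,h:V\to\mathbb{R}$ be positive functions. Then the $1$-Yamabe equation $$-\Delta_1u+g\,\mathrm{Sgn}(u)=h|u|^{\alpha-1}\mathrm{Sgn}(u)$$ has a nontrivial solution $u\in C(V)$ with $u\geq 0$ and $u\neq 0$. That is, there exists a function $u:V\to\mathbb{R}$ with $u(x)\ge 0$ for all $x\in V$, $u$ not identically zero, such that at every vertex $x\in V$ $$\Big(-\Delta_1u(x)+g(x)\,\mathrm{Sgn}(u(x))\Big)\cap\Big(h(x)|u(x)|^{\alpha-1}\mathrm{Sgn}(u(x))\Big)\neq\emptyset .$$
   Context: $C(V)$ is the set of all real functions on $V$. The edge measure is symmetric: $w_{xy}=w_{yx}$ for each edge $x\sim y$. The set-valued sign function is $\mathrm{Sgn}(t)=\{1\}$ if $t>0$, $\mathrm{Sgn}(t)=\{-1\}$ if $t<0$, and $\mathrm{Sgn}(0)=[-1,1]$. For subsets $A,B\subset\mathbb{R}$ and a scalar $c$, $A+B=\{a+b: a\in A,\ b\in B\}$ and $cA=\{ca: a\in A\}$. The (set-valued) discrete $1$-Laplacian is $$\Delta_1 f(x)=\frac{1}{\mu(x)}\sum_{y\sim x}w_{xy}\,\mathrm{Sgn}(f(y)-f(x))\subset\mathbb{R},\qquad f\in C(V),\ x\in V,$$ where the sum is a sum of sets. A function $u\in C(V)$ is a solution of the $1$-Yamabe equation if at each vertex $x$ the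 sets $A^+(x)=-\Delta_1u(x)+g(x)\mathrm{Sgn}(u(x))$ and $A^-(x)=h(x)|u(x)|^{\alpha-1}\mathrm{Sgn}(u(x))$ have nonempty intersection. *)

theory Defs
  imports
    Complex_Main
    "HOL-Library.Set_Algebras"
    "Graph_Theory.Digraph_Component"
begin

text \<open>
  A finite simple undirected graph is a \<open>pair_graph\<close>: finite, without loops, and with a
  symmetric set of arcs, so that \<open>x \<sim> y\<close> is \<open>(x, y) \<in> parcs G\<close>. Functions on vertices
  and edges are total; only their values on the vertices and edges of \<open>G\<close> are used.
\<close>

definition Sgn :: "real \<Rightarrow> real set" where
  "Sgn t = (if t > 0 then {1} else if t < 0 then {-1} else {-1..1})"

text \<open>
  Here \<open>+\<close> and \<open>\<Sum>\<close> on sets are Minkowski sums (the empty sum is \<open>{0}\<close>), and \<open>c *o A\<close>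
  is the set of all \<open>c * a\<close> with \<open>a \<in> A\<close>.
\<close>

definition one_laplacian ::
  "'a pair_pre_digraph \<Rightarrow> ('a \<Rightarrow> real) \<Rightarrow> ('a \<Rightarrow> 'a \<Rightarrow> real) \<Rightarrow> ('a \<Rightarrow> real) \<Rightarrow> 'a \<Rightarrow> real set" where
  "one_laplacian G \<mu> w f x =
     (1 / \<mu> x) *o (\<Sum>y | (x, y) \<in> parcs G. w x y *o Sgn (f y - f x))"

text \<open>
  The negative of a set is written \<open>(- 1) *o A\<close>, since \<open>- A\<close> denotes the complement.
\<close>

definition yamabe_solution ::
  "'a pair_pre_digraph \<Rightarrow> ('a \<Rightarrow> real) \<Rightarrow> ('a \<Rightarrow> 'a \<Rightarrow> real) \<Rightarrow> ('a \<Rightarrow> real) \<Rightarrow> ('a \<Rightarrow> real) \<Rightarrow> real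
     \<Rightarrow> ('a \<Rightarrow> real) \<Rightarrow> bool" where
  "yamabe_solution G \<mu> w g h \<alpha> u \<longleftrightarrow>
     (\<forall>x \<in> pverts G.
        ((- 1) *o one_laplacian G \<mu> w u x + g x *o Sgn (u x)) \<inter>
        ((h x * \<bar>u x\<bar> powr (\<alpha> - 1)) *o Sgn (u x)) \<noteq> {})"

end

theory Submission
  imports Defs "HOL-Analysis.Analysis"
begin

text \<open>
  Let \<open>energy u\<close> be the total variation of \<open>u\<close> plus \<open>\<Sum> g \<mu> u\<close> and \<open>mass u = \<Sum> h \<mu> u\<^sup>\<alpha>\<close>.
  Maximise \<open>mass u / energy u\<^sup>\<alpha>\<close> over nonzero \<open>u \<ge> 0\<close>, and rescale the maximiser so that its
  mass and energy agree. In the \<open>1\<close>-Laplacian the elements of the sets \<open>Sgn (u y - u x)\<close> are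
  chosen independently at each vertex, so no multiplier theorem is needed: the one-sided
  derivatives of the quotient in the single variable \<open>u x\<close> already give the inclusion at \<open>x\<close>.
\<close>

section \<open>One-sided derivatives of absolute values and powers\<close>

definition right_slope :: "real \<Rightarrow> real \<Rightarrow> real" where
  "right_slope c t = (if t < c then -1 else 1)"

text \<open>The two slopes differ only at the kink \<open>t = c\<close>. In every case
  \<open>Sgn (c - t)\<close> is the interval from \<open>- right_slope c t\<close> to
  \<open>- left_slope c t\<close>, which links one-sided derivatives of the total variation to the
  1-Laplacian.\<close>

definition left_slope :: "real \<Rightarrow> real \<Rightarrow> real" where
  "left_slope c t = (if c < t then 1 else -1)"

lemma abs_diff_has_right_derivative:
  "((\<lambda>t. \<bar>c - t\<bar>) has_real_derivative right_slope c s) (at s within {s..})"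
proof (cases "s < c")
  case True
  have "((\<lambda>t. c - t) has_real_derivative -1) (at s)"
    by (auto intro!: derivative_eq_intros)
  moreover have "\<forall>\<^sub>F t in nhds s. \<bar>c - t\<bar> = c - t"
    using eventually_nhds_in_open[of "{..<c}" s] True by (auto elim!: eventually_mono)
  ultimately have "((\<lambda>t. \<bar>c - t\<bar>) has_real_derivative -1) (at s)"
    by (subst DERIV_cong_ev[OF refl _ refl])
  then show ?thesis
    using True by (simp add: right_slope_def has_field_derivative_at_within)
next
  case False
  have "((\<lambda>t. t - c) has_real_derivative 1) (at s within {s..})"
    by (auto intro!: derivative_eq_intros)
  then have "((\<lambda>t. \<bar>c - t\<bar>) has_real_derivative 1) (at s within {s..})"
    by (rule has_field_derivative_transform_within[OF _ zero_less_one]) (use False in auto)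
  then show ?thesis
    using False by (simp add: right_slope_def)
qed

lemma abs_diff_has_left_derivative:
  "((\<lambda>t. \<bar>c - t\<bar>) has_real_derivative left_slope c s) (at s within {..s})"
proof (cases "c < s")
  case True
  have "((\<lambda>t. t - c) has_real_derivative 1) (at s)"
    by (auto intro!: derivative_eq_intros)
  moreover have "\<forall>\<^sub>F t in nhds s. \<bar>c - t\<bar> = t - c"
    using eventually_nhds_in_open[of "{c<..}" s] True by (auto elim!: eventually_mono)
  ultimately have "((\<lambda>t. \<bar>c - t\<bar>) has_real_derivative 1) (at s)"
    by (subst DERIV_cong_ev[OF refl _ refl])
  then show ?thesis
    using True by (simp add: left_slope_def has_field_derivative_at_within)
next
  case False
  have "((\<lambda>t. c - t) has_real_derivative -1) (at s within {..s})"
    by (auto intro!: derivative_eq_intros)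
  then have "((\<lambda>t. \<bar>c - t\<bar>) has_real_derivative -1) (at s within {..s})"
    by (rule has_field_derivative_transform_within[OF _ zero_less_one]) (use False in auto)
  then show ?thesis
    using False by (simp add: left_slope_def)
qed

text \<open>At \<open>s = 0\<close> the difference quotient is \<open>t powr (\<alpha> - 1)\<close>,
  which tends to 0 because \<alpha> > 1, so the usual formula persists there.\<close>

lemma powr_has_derivative_within_nonneg:
  fixes \<alpha> s :: real
  assumes "\<alpha> > 1" "s \<ge> 0"
  shows "((\<lambda>t. t powr \<alpha>) has_real_derivative \<alpha> * s powr (\<alpha> - 1)) (at s within {0..})"
proof (cases "s = 0")
  case False
  then show ?thesis
    using assms by (simp add: has_field_derivative_at_within has_real_derivative_powr)
next
  case True
  have lim: "((\<lambda>t. t powr (\<alpha> - 1)) \<longlongrightarrow> 0 powr (\<alpha> - 1)) (at 0 within {0..})"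
    using assms by (intro tendsto_powr' tendsto_ident_at tendsto_const) (auto simp: eventually_at_filter)
  have "t powr (\<alpha> - 1) = (t powr \<alpha> - 0 powr \<alpha>) / (t - 0)" if "t \<in> {0..}" "t \<noteq> 0" for t
    using that by (simp add: powr_diff)
  then have "((\<lambda>t. (t powr \<alpha> - 0 powr \<alpha>) / (t - 0)) \<longlongrightarrow> 0 powr (\<alpha> - 1)) (at 0 within {0..})"
    using Lim_transform_within[OF lim zero_less_one] by auto
  then show ?thesis
    using True by (simp add: has_field_derivative_iff)
qed

section \<open>First-order conditions at a one-sided maximum\<close>

lemma right_derivative_nonpos_at_max:
  fixes f :: "real \<Rightarrow> real"
  assumes "(f has_real_derivative l) (at s within {s..})" "\<And>t. t \<ge> s \<Longrightarrow> f t \<le> f s"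
  shows "l \<le> 0"
proof (rule ccontr)
  assume "\<not> l \<le> 0"
  then obtain d where "d > 0" "\<forall>r>0. s + r \<in> {s..} \<longrightarrow> r < d \<longrightarrow> f s < f (s + r)"
    using has_real_derivative_pos_inc_right[OF assms(1)] by auto
  then have "f s < f (s + d/2)" by auto
  then show False using assms(2)[of "s + d/2"] \<open>d > 0\<close> by auto
qed

text \<open>The interval stops at \<open>r\<close> because a coordinate may be lowered only as long
  as it stays nonnegative; \<open>r\<close> will be 0.\<close>

lemma left_derivative_nonneg_at_max:
  fixes f :: "real \<Rightarrow> real"
  assumes "(f has_real_derivative l) (at s within {r..s})" "r < s"
    and "\<And>t. r \<le> t \<Longrightarrow> t \<le> s \<Longrightarrow> f t \<le> f s"
  shows "l \<ge> 0"
proof (rule ccontr)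
  assume "\<not> l \<ge> 0"
  then obtain d where d: "d > 0" "\<forall>h>0. s - h \<in> {r..s} \<longrightarrow> h < d \<longrightarrow> f s < f (s - h)"
    using has_real_derivative_neg_dec_left[OF assms(1)] by auto
  define h where "h = min (d/2) (s - r)"
  have "h > 0" "h < d" "r \<le> s - h" "s - h \<le> s"
    using d(1) assms(2) by (auto simp: h_def)
  then have "f s < f (s - h)" using d(2) by auto
  then show False using assms(3)[of "s - h"] \<open>h > 0\<close> \<open>r \<le> s - h\<close> by auto
qed

section \<open>Interpolation inside a Minkowski sum of \<open>Sgn\<close> sets\<close>

lemma convex_combination_exists:
  fixes a b c :: real
  assumes "a \<le> c" "c \<le> b"
  obtains \<theta> where "0 \<le> \<theta>" "\<theta> \<le> 1" "c = a + \<theta> * (b - a)"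
proof (cases "a = b")
  case True
  then show ?thesis using assms that[of 0] by auto
next
  case False
  then show ?thesis using assms that[of "(c - a) / (b - a)"] by (auto simp: field_simps)
qed

text \<open>One parameter \<theta>, shared by all summands, interpolates between the two bounds and
  hits \<open>c\<close>. Each negated interpolated slope lies in its own \<open>Sgn\<close> set,
  since both negated slopes do and the set is an interval.\<close>

lemma mem_sum_Sgn:
  assumes "finite N"
    and "(\<Sum>y\<in>N. w y * left_slope (f y) s) \<le> c"
    and "c \<le> (\<Sum>y\<in>N. w y * right_slope (f y) s)"
  shows "- c \<in> (\<Sum>y\<in>N. w y *o Sgn (f y - s))"
proof -
  let ?L = "\<lambda>y. left_slope (f y) s" and ?R = "\<lambda>y. right_slope (f y) s"
  obtain \<theta> where \<theta>: "0 \<le> \<theta>" "\<theta> \<le> 1"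
    "c = (\<Sum>y\<in>N. w y * ?L y) + \<theta> * ((\<Sum>y\<in>N. w y * ?R y) - (\<Sum>y\<in>N. w y * ?L y))"
    using convex_combination_exists[OF assms(2,3)] .
  define p where "p y = - (?L y + \<theta> * (?R y - ?L y))" for y
  have "p y \<in> Sgn (f y - s)" for y
    using \<theta>(1,2) by (auto simp: p_def Sgn_def left_slope_def right_slope_def)
  then have "\<forall>y\<in>N. w y * p y \<in> w y *o Sgn (f y - s)"
    by (auto simp: elt_set_times_def)
  moreover have "- c = (\<Sum>y\<in>N. w y * p y)"
    unfolding \<theta>(3) p_def
    by (simp add: sum_distrib_left algebra_simps sum.distrib sum_subtractf sum_negf)
  ultimately show ?thesis
    unfolding set_sum_alt[OF assms(1)] by auto
qed

section \<open>The energy and mass functionals: homogeneity and positivity\<close>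

locale weighted_yamabe_graph = pair_graph +
  fixes \<mu> g h :: "'a \<Rightarrow> real" and w :: "'a \<Rightarrow> 'a \<Rightarrow> real" and \<alpha> :: real
  assumes verts_nonempty: "pverts G \<noteq> {}"
    and mu_pos: "x \<in> pverts G \<Longrightarrow> \<mu> x > 0"
    and w_pos: "(x, y) \<in> parcs G \<Longrightarrow> w x y > 0"
    and w_sym: "(x, y) \<in> parcs G \<Longrightarrow> w x y = w y x"
    and alpha_gt_1: "\<alpha> > 1"
    and g_pos: "x \<in> pverts G \<Longrightarrow> g x > 0"
    and h_pos: "x \<in> pverts G \<Longrightarrow> h x > 0"
begin

definition nbrs :: "'a \<Rightarrow> 'a set" where
  "nbrs x = {y. (x, y) \<in> parcs G}"

text \<open>Each undirected edge occurs as two arcs, hence the division by 2. The potential term is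
  linear in \<open>u\<close>, so it is a weighted 1-norm only for nonnegative
  \<open>u\<close>.\<close>

definition energy :: "('a \<Rightarrow> real) \<Rightarrow> real" where
  "energy u = (\<Sum>(x, y)\<in>parcs G. w x y * \<bar>u y - u x\<bar>) / 2 + (\<Sum>x\<in>pverts G. g x * \<mu> x * u x)"

definition mass :: "('a \<Rightarrow> real) \<Rightarrow> real" where
  "mass u = (\<Sum>x\<in>pverts G. h x * \<mu> x * u x powr \<alpha>)"

definition nonneg :: "('a \<Rightarrow> real) \<Rightarrow> bool" where
  "nonneg u \<longleftrightarrow> (\<forall>x\<in>pverts G. u x \<ge> 0)"

lemma finite_nbrs: "finite (nbrs x)"
proof -
  have "nbrs x \<subseteq> snd ` parcs G" by (force simp: nbrs_def)
  then show ?thesis using pair_finite_arcs finite_surj by blast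
qed

lemma arcs_sym: "(x, y) \<in> parcs G \<longleftrightarrow> (y, x) \<in> parcs G"
  using pair_sym_arcs unfolding symmetric_def by (auto elim: symE)

lemma no_loop: "(x, x) \<notin> parcs G"
  using pair_no_loops[of "(x, x)"] by auto

lemma energy_scale:
  assumes "c \<ge> 0"
  shows "energy (\<lambda>x. c * u x) = c * energy u"
proof -
  have "\<bar>c * u y - c * u x\<bar> = c * \<bar>u y - u x\<bar>" for x y
    using assms by (metis abs_mult abs_of_nonneg right_diff_distrib)
  then show ?thesis
    by (simp add: energy_def sum_distrib_left algebra_simps case_prod_unfold sum_divide_distrib)
qed

lemma mass_scale:
  assumes "c \<ge> 0" "nonneg u"
  shows "mass (\<lambda>x. c * u x) = c powr \<alpha> * mass u"
  unfolding mass_def sum_distrib_left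
  using assms by (intro sum.cong refl) (simp add: powr_mult nonneg_def)

lemma energy_pos:
  assumes "nonneg u" "x \<in> pverts G" "u x \<noteq> 0"
  shows "energy u > 0"
proof -
  have "0 < (\<Sum>x\<in>pverts G. g x * \<mu> x * u x)"
    using assms pair_finite_verts g_pos mu_pos
    by (intro sum_pos2[of _ x]) (auto simp: nonneg_def less_le)
  moreover have "0 \<le> (\<Sum>(x, y)\<in>parcs G. w x y * \<bar>u y - u x\<bar>)"
    using w_pos by (intro sum_nonneg) (auto simp: less_imp_le)
  ultimately show ?thesis by (simp add: energy_def)
qed

lemma mass_pos:
  assumes "nonneg u" "x \<in> pverts G" "u x \<noteq> 0"
  shows "mass u > 0"
  unfolding mass_def
  using assms pair_finite_verts h_pos mu_pos
  by (intro sum_pos2[of _ x]) (auto simp: less_imp_le)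

section \<open>Dependence of both functionals on a single coordinate\<close>

lemma energy_upd:
  assumes "x \<in> pverts G"
  shows "\<exists>C. \<forall>t. energy (u(x := t)) = C + (\<Sum>y\<in>nbrs x. w x y * \<bar>u y - t\<bar>) + g x * \<mu> x * t"
proof -
  let ?F = "\<lambda>t (a, b). w a b * \<bar>(u(x := t)) b - (u(x := t)) a\<bar>"
  \<comment> \<open>These are the arcs leaving and entering \<open>x\<close>, disjoint because there
    are no loops. By symmetry of \<open>w\<close> both contribute the same sum over the neighbours,
    and the factor 1/2 in \<open>energy\<close> leaves one copy.\<close>
  let ?O = "Pair x ` nbrs x" and ?I = "(\<lambda>y. (y, x)) ` nbrs x"
  define R where "R = parcs G - ?O - ?I"
  have sub: "?O \<subseteq> parcs G" "?I \<subseteq> parcs G - ?O"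
    using arcs_sym no_loop by (auto simp: nbrs_def)
  have "x \<notin> nbrs x" using no_loop by (simp add: nbrs_def)
  then have O: "sum (?F t) ?O = (\<Sum>y\<in>nbrs x. w x y * \<bar>u y - t\<bar>)"
    and I: "sum (?F t) ?I = (\<Sum>y\<in>nbrs x. w x y * \<bar>u y - t\<bar>)" for t
    using w_sym by (auto simp: sum.reindex inj_on_def nbrs_def abs_minus_commute intro!: sum.cong)
  have "(a, b) \<in> R \<Longrightarrow> a \<noteq> x \<and> b \<noteq> x" for a b
    using arcs_sym by (auto simp: R_def nbrs_def)
  \<comment> \<open>The remaining arcs avoid \<open>x\<close>, so their sum is constant in
    \<open>t\<close>; the value \<open>u x\<close> is merely a representative.\<close>
  then have R: "sum (?F t) R = sum (?F (u x)) R" for t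
    by (intro sum.cong) auto
  have arcs: "sum (?F t) (parcs G) = sum (?F (u x)) R + 2 * (\<Sum>y\<in>nbrs x. w x y * \<bar>u y - t\<bar>)" for t
    using sum.subset_diff[OF sub(1) pair_finite_arcs, of "?F t"]
      sum.subset_diff[OF sub(2), of "?F t"] pair_finite_arcs O[of t] I[of t] R[of t]
    by (simp add: R_def)
  have verts: "(\<Sum>a\<in>pverts G. g a * \<mu> a * (u(x := t)) a)
      = g x * \<mu> x * t + (\<Sum>a\<in>pverts G - {x}. g a * \<mu> a * u a)" for t
    using assms pair_finite_verts by (subst sum.remove[of _ x]) (auto intro!: sum.cong)
  show ?thesis
    unfolding energy_def arcs verts
    by (rule exI[of _ "sum (?F (u x)) R / 2 + (\<Sum>a\<in>pverts G - {x}. g a * \<mu> a * u a)"]) simp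
qed

lemma mass_upd:
  assumes "x \<in> pverts G"
  shows "\<exists>C. \<forall>t. mass (u(x := t)) = C + h x * \<mu> x * t powr \<alpha>"
proof -
  have "mass (u(x := t)) = (\<Sum>a\<in>pverts G - {x}. h a * \<mu> a * u a powr \<alpha>) + h x * \<mu> x * t powr \<alpha>" for t
    unfolding mass_def
    using assms pair_finite_verts by (subst sum.remove[of _ x]) (auto intro!: sum.cong)
  then show ?thesis by blast
qed

text \<open>Keeping the slope \<open>d\<close> and the set \<open>S\<close> abstract lets one proof
  serve both the right and the left derivative.\<close>

lemma energy_upd_has_derivative:
  assumes "x \<in> pverts G"
    and "\<And>c. ((\<lambda>t. \<bar>c - t\<bar>) has_real_derivative d c) (at s within S)"
  shows "((\<lambda>t. energy (u(x := t))) has_real_derivative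
    (\<Sum>y\<in>nbrs x. w x y * d (u y)) + g x * \<mu> x) (at s within S)"
proof -
  obtain C where C:
    "\<And>t. energy (u(x := t)) = C + (\<Sum>y\<in>nbrs x. w x y * \<bar>u y - t\<bar>) + g x * \<mu> x * t"
    using energy_upd[OF assms(1)] by blast
  show ?thesis
    unfolding C
    by (rule derivative_eq_intros DERIV_sum assms(2) refl | simp add: mult.commute)+
qed

lemma mass_upd_has_derivative:
  assumes "x \<in> pverts G" "s \<ge> 0" "S \<subseteq> {0..}"
  shows "((\<lambda>t. mass (u(x := t))) has_real_derivative h x * \<mu> x * (\<alpha> * s powr (\<alpha> - 1))) (at s within S)"
proof -
  obtain C where C: "\<And>t. mass (u(x := t)) = C + h x * \<mu> x * t powr \<alpha>"
    using mass_upd[OF assms(1)] by blast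
  have "((\<lambda>t. t powr \<alpha>) has_real_derivative \<alpha> * s powr (\<alpha> - 1)) (at s within S)"
    using powr_has_derivative_within_nonneg[OF alpha_gt_1 assms(2)] assms(3) DERIV_subset by blast
  then show ?thesis
    unfolding C using DERIV_add[OF DERIV_const DERIV_cmult] by fastforce
qed

section \<open>Compactness, continuity and existence of a maximiser\<close>

lemma continuous_on_coordinate: "continuous_on S (\<lambda>u::'a \<Rightarrow> real. u x)"
  by (rule continuous_on_subset[OF continuous_on_product_coordinates subset_UNIV])

lemma continuous_on_energy: "continuous_on S energy"
  unfolding energy_def[abs_def] case_prod_unfold
  by (intro continuous_intros continuous_on_coordinate) simp

lemma continuous_on_mass: "continuous_on {u. nonneg u} mass"
  unfolding mass_def[abs_def]
  using alpha_gt_1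
  by (intro continuous_intros continuous_on_coordinate continuous_on_powr') (auto simp: nonneg_def)

text \<open>Functions live on all of \<open>'a\<close>, which may be infinite. Forcing the value 0
  off the vertices places the set in a product of compact factors, compact by Tychonoff's theorem;
  the normalisation then cuts out a closed subset.\<close>

lemma compact_simplex:
  "compact {u. nonneg u \<and> sum u (pverts G) = 1 \<and> (\<forall>x. x \<notin> pverts G \<longrightarrow> u x = 0)}" (is "compact ?K")
proof -
  let ?B = "PiE UNIV (\<lambda>x. if x \<in> pverts G then {0..1::real} else {0})"
  have "compactin (product_topology (\<lambda>_. euclidean) UNIV) ?B"
    by (subst compactin_PiE) auto
  then have "compact ?B"
    by (simp add: euclidean_product_topology)
  moreover have "closed {u::'a \<Rightarrow> real. sum u (pverts G) = 1}"
    by (intro closed_Collect_eq continuous_intros continuous_on_coordinate)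
  ultimately have "compact (?B \<inter> {u. sum u (pverts G) = 1})"
    by (rule compact_Int_closed)
  moreover have "?K = ?B \<inter> {u. sum u (pverts G) = 1}"
  proof (intro set_eqI iffI)
    fix u assume u: "u \<in> ?K"
    have "u x \<le> 1" if "x \<in> pverts G" for x
      using member_le_sum[of x "pverts G" u] u that pair_finite_verts by (auto simp: nonneg_def)
    then show "u \<in> ?B \<inter> {u. sum u (pverts G) = 1}"
      using u by (auto simp: nonneg_def PiE_iff)
  next
    fix u assume u: "u \<in> ?B \<inter> {u. sum u (pverts G) = 1}"
    then have "u x \<in> (if x \<in> pverts G then {0..1} else {0})" for x
      by (auto simp: PiE_iff)
    then have "nonneg u" "\<forall>x. x \<notin> pverts G \<longrightarrow> u x = 0"
      unfolding nonneg_def by (metis atLeastAtMost_iff, metis singletonD)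
    then show "u \<in> ?K" using u by auto
  qed
  ultimately show ?thesis by simp
qed

text \<open>
  The quotient is scaling invariant, so a simplex suffices; the rescaling uses \<open>\<alpha> \<noteq> 1\<close>.
\<close>

lemma quotient_maximiser_exists:
  obtains u x where "nonneg u" "x \<in> pverts G" "u x \<noteq> 0" "energy u = mass u"
    and "\<And>v. nonneg v \<Longrightarrow> mass v * energy u powr \<alpha> \<le> mass u * energy v powr \<alpha>"
proof -
  let ?K = "{u. nonneg u \<and> sum u (pverts G) = 1 \<and> (\<forall>x. x \<notin> pverts G \<longrightarrow> u x = 0)}"
  have nz: "\<exists>x\<in>pverts G. u x \<noteq> 0" if "u \<in> ?K" for u
    using that by (force intro: ccontr)
  have epos: "energy u > 0" if "u \<in> ?K" for u
    using energy_pos nz[OF that] that by blast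
  have "(\<lambda>x. if x \<in> pverts G then 1 / card (pverts G) else 0) \<in> ?K"
    using verts_nonempty pair_finite_verts by (auto simp: nonneg_def)
  then have "?K \<noteq> {}" by blast
  moreover have "continuous_on ?K (\<lambda>u. mass u / energy u powr \<alpha>)"
    using epos
    by (intro continuous_intros continuous_on_powr' continuous_on_energy
        continuous_on_subset[OF continuous_on_mass]) (auto simp: less_imp_le less_le)
  ultimately obtain u where u: "u \<in> ?K"
    and max: "\<And>v. v \<in> ?K \<Longrightarrow> mass v / energy v powr \<alpha> \<le> mass u / energy u powr \<alpha>"
    using continuous_attains_sup[OF compact_simplex, of "\<lambda>u. mass u / energy u powr \<alpha>"]
    by (metis (no_types, lifting))
  obtain x where x: "x \<in> pverts G" "u x \<noteq> 0" using nz[OF u] by blast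
  have nu: "nonneg u" using u by simp
  have eu: "energy u > 0" and mu: "mass u > 0"
    using energy_pos mass_pos nu x by auto
  \<comment> \<open>Maximality passes from the simplex to all nonnegative \<open>v\<close>. The
    cross-multiplied form also covers a \<open>v\<close> vanishing on the vertices, where the
    quotient would have denominator 0.\<close>
  have opt: "mass v * energy u powr \<alpha> \<le> mass u * energy v powr \<alpha>" if v: "nonneg v" for v
  proof (cases "\<exists>y\<in>pverts G. v y \<noteq> 0")
    case False
    then have "mass v = 0" by (simp add: mass_def)
    then show ?thesis using mu by simp
  next
    case True
    then have ev: "energy v > 0" using energy_pos v by blast
    define c where "c = sum v (pverts G)"
    obtain y where "y \<in> pverts G" "v y \<noteq> 0" using True by blast
    then have c: "c > 0"
      unfolding c_def using v pair_finite_verts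
      by (intro sum_pos2[of _ y]) (auto simp: nonneg_def less_le)
    \<comment> \<open>Normalise \<open>v\<close> to total 1 and cut it off outside the vertices.
      Mass and energy see only vertex values, and the quotient is invariant because numerator and
      denominator are both homogeneous of degree \<alpha>.\<close>
    define v' where "v' = (\<lambda>y. if y \<in> pverts G then 1 / c * v y else 0)"
    have "sum v' (pverts G) = 1"
      using c by (simp add: v'_def c_def flip: sum_divide_distrib)
    then have K: "v' \<in> ?K" using v c by (auto simp: v'_def nonneg_def)
    have "mass v' = mass (\<lambda>y. 1 / c * v y)"
      by (simp add: mass_def v'_def)
    moreover have "energy v' = energy (\<lambda>y. 1 / c * v y)"
      unfolding energy_def v'_def
      by (intro arg_cong2[where f = "(+)"] arg_cong2[where f = "(/)"] sum.cong)
        (auto dest: in_arcsD1 in_arcsD2)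
    ultimately have "mass v' / energy v' powr \<alpha> = mass v / energy v powr \<alpha>"
      using c v ev energy_scale[of "1/c" v] mass_scale[of "1/c" v]
      by (simp add: powr_mult powr_divide)
    then have "mass v / energy v powr \<alpha> \<le> mass u / energy u powr \<alpha>"
      using max[OF K] by simp
    then show ?thesis
      using ev eu by (simp add: field_simps)
  qed
  \<comment> \<open>This \<open>c\<close> solves
    \<open>c powr \<alpha> * mass u = c * energy u\<close>, which says that mass and energy of the
    rescaled function agree.\<close>
  define c where "c = (energy u / mass u) powr (1 / (\<alpha> - 1))"
  have c: "c > 0" using eu mu by (simp add: c_def)
  have "c powr (\<alpha> - 1) = energy u / mass u"
    using alpha_gt_1 eu mu by (simp add: c_def powr_powr)
  then have "c powr \<alpha> * mass u = c * energy u"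
    using c mu by (simp add: powr_diff field_simps)
  then have "energy (\<lambda>y. c * u y) = mass (\<lambda>y. c * u y)"
    using c nu by (simp add: energy_scale mass_scale)
  moreover have "mass v * energy (\<lambda>y. c * u y) powr \<alpha> \<le> mass (\<lambda>y. c * u y) * energy v powr \<alpha>"
    if "nonneg v" for v
    using opt[OF that] c nu eu
    by (simp add: energy_scale mass_scale powr_mult mult.left_commute mult.assoc)
  ultimately show ?thesis
    using that[of "\<lambda>y. c * u y" x] nu x c by (auto simp: nonneg_def)
qed

section \<open>One-sided optimality conditions and the inclusion at each vertex\<close>

lemma maximiser_one_sided_derivative:
  assumes u: "nonneg u" "energy u = mass u" "energy u > 0" and x: "x \<in> pverts G"
    and opt: "\<And>v. nonneg v \<Longrightarrow> mass v * energy u powr \<alpha> \<le> mass u * energy v powr \<alpha>"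
    and d: "\<And>c. ((\<lambda>t. \<bar>c - t\<bar>) has_real_derivative d c) (at (u x) within S)"
    and S: "S \<subseteq> {0..}"
  obtains f l where "(f has_real_derivative l) (at (u x) within S)"
    "\<And>t. t \<in> S \<Longrightarrow> f t \<le> f (u x)"
    "sgn l = sgn (h x * \<mu> x * u x powr (\<alpha> - 1) - ((\<Sum>y\<in>nbrs x. w x y * d (u y)) + g x * \<mu> x))"
proof -
  let ?e = "energy u" and ?D = "(\<Sum>y\<in>nbrs x. w x y * d (u y)) + g x * \<mu> x"
  \<comment> \<open>This is the difference of the two sides of \<open>opt\<close> for
    \<open>v = u(x := t)\<close>, with \<open>mass u\<close> replaced by the equal
    \<open>energy u\<close>. Hence \<open>f t \<le> 0\<close> for admissible \<open>t\<close>, with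
    equality at \<open>t = u x\<close>.\<close>
  define f where "f t = mass (u(x := t)) * ?e powr \<alpha> - ?e * energy (u(x := t)) powr \<alpha>" for t
  have ux: "u x \<ge> 0" using u x by (auto simp: nonneg_def)
  have "((\<lambda>t. energy (u(x := t)) powr \<alpha>) has_real_derivative (\<alpha> * ?e powr (\<alpha> - 1)) * ?D)
      (at (u x) within S)"
    using DERIV_chain2[OF _ energy_upd_has_derivative[OF x d, of u], of "\<lambda>z. z powr \<alpha>"]
      has_real_derivative_powr[OF u(3), of \<alpha>] by simp
  then have "(f has_real_derivative h x * \<mu> x * (\<alpha> * u x powr (\<alpha> - 1)) * ?e powr \<alpha>
      - ?e * ((\<alpha> * ?e powr (\<alpha> - 1)) * ?D)) (at (u x) within S)"
    unfolding f_def
    by (intro DERIV_diff DERIV_cmult_right DERIV_cmult mass_upd_has_derivative x ux S)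
  \<comment> \<open>Because the coefficient of the second term is the energy itself, the positive
    factor \<open>\<alpha> * ?e powr \<alpha>\<close> comes out of both terms. Only the sign of the
    remaining factor matters later.\<close>
  moreover have "h x * \<mu> x * (\<alpha> * u x powr (\<alpha> - 1)) * ?e powr \<alpha> - ?e * ((\<alpha> * ?e powr (\<alpha> - 1)) * ?D)
      = \<alpha> * ?e powr \<alpha> * (h x * \<mu> x * u x powr (\<alpha> - 1) - ?D)"
    using u(3) by (simp add: powr_diff algebra_simps)
  ultimately have "(f has_real_derivative \<alpha> * ?e powr \<alpha> * (h x * \<mu> x * u x powr (\<alpha> - 1) - ?D))
      (at (u x) within S)" by simp
  moreover have "f t \<le> f (u x)" if "t \<in> S" for t
  proof -
    have "nonneg (u(x := t))" using u that S by (auto simp: nonneg_def)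
    then show ?thesis using opt[of "u(x := t)"] u(2) by (simp add: f_def)
  qed
  ultimately show ?thesis
    using that u(3) alpha_gt_1 by (simp add: sgn_mult)
qed

lemma yamabe_solution_exists:
  "\<exists>u. nonneg u \<and> (\<exists>x\<in>pverts G. u x \<noteq> 0) \<and> yamabe_solution G \<mu> w g h \<alpha> u"
proof -
  obtain u x\<^sub>0 where u1: "nonneg u" and x\<^sub>0: "x\<^sub>0 \<in> pverts G" "u x\<^sub>0 \<noteq> 0"
    and u2: "energy u = mass u" and opt: "\<And>v. nonneg v \<Longrightarrow> mass v * energy u powr \<alpha> \<le> mass u * energy v powr \<alpha>"
    by (rule quotient_maximiser_exists) blast
  note u = u1 u2
  have eu: "energy u > 0" using energy_pos u(1) x\<^sub>0 by blast
  have "((- 1) *o one_laplacian G \<mu> w u x + g x *o Sgn (u x)) \<inter>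
        ((h x * \<bar>u x\<bar> powr (\<alpha> - 1)) *o Sgn (u x)) \<noteq> {}" if x: "x \<in> pverts G" for x
  proof -
    let ?a = "\<Sum>y\<in>nbrs x. w x y * left_slope (u y) (u x)"
    let ?b = "\<Sum>y\<in>nbrs x. w x y * right_slope (u y) (u x)"
    let ?H = "h x * u x powr (\<alpha> - 1)"
    have ux: "u x \<ge> 0" and mx: "\<mu> x > 0" and gx: "g x > 0"
      using u x mu_pos g_pos by (auto simp: nonneg_def)
    \<comment> \<open>Any \<open>c\<close> between the left and right slope sums may be used, and
      the resulting element is \<open>c / \<mu> x + g x * s\<close>. It remains to choose
      \<open>c\<close> and \<open>s\<close>.\<close>
    have witness: "(- 1) * (1 / \<mu> x * (- c)) + g x * s
        \<in> (- 1) *o one_laplacian G \<mu> w u x + g x *o Sgn (u x)"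
      if "?a \<le> c" "c \<le> ?b" "s \<in> Sgn (u x)" for c s
      unfolding one_laplacian_def nbrs_def[symmetric]
      by (intro set_plus_intro set_times_intro2 mem_sum_Sgn finite_nbrs that)
    \<comment> \<open>Raising \<open>u x\<close> preserves nonnegativity, so the right derivative
      gives an upper bound at every vertex.\<close>
    obtain f l where f: "(f has_real_derivative l) (at (u x) within {u x..})"
      "\<And>t. t \<in> {u x..} \<Longrightarrow> f t \<le> f (u x)"
      "sgn l = sgn (h x * \<mu> x * u x powr (\<alpha> - 1) - (?b + g x * \<mu> x))"
      using maximiser_one_sided_derivative[OF u eu x opt abs_diff_has_right_derivative] ux by auto
    have "l \<le> 0" using right_derivative_nonpos_at_max[OF f(1)] f(2) by auto
    then have upper: "\<mu> x * (?H - g x) \<le> ?b"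
      using f(3) by (auto simp: sgn_if algebra_simps split: if_splits)
    show ?thesis
    proof (cases "u x = 0")
      case True
      \<comment> \<open>Here \<open>u x\<close> cannot be lowered, so 0 is sought in both sets:
        \<open>c / \<mu> x + g x * s = 0\<close> with \<open>s\<close> in [-1, 1]. As
        \<open>?H = 0\<close>, the upper bound gives \<open>- (\<mu> x * g x) \<le> ?b\<close>, so
        this \<open>c\<close> puts \<open>s = - c / \<mu> x / g x\<close> in [0, 1]. No neighbour
        has a smaller value, so all left slopes are -1 and \<open>?a \<le> 0\<close>.\<close>
      define c where "c = min ?b 0"
      have "?a \<le> ?b" "?a \<le> 0"
        using w_pos u(1) in_arcsD2 True
        by (auto simp: nbrs_def left_slope_def right_slope_def nonneg_def less_imp_le
            intro!: sum_mono sum_nonpos) (force simp: less_imp_le not_less)+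
      then have "?a \<le> c" "c \<le> ?b" by (auto simp: c_def)
      moreover have "- (\<mu> x * g x) \<le> c" "c \<le> 0"
        using upper True mx gx by (auto simp: c_def)
      then have "- c / \<mu> x / g x \<in> Sgn (u x)"
        using True mx gx by (auto simp: Sgn_def field_simps)
      ultimately have "0 \<in> (- 1) *o one_laplacian G \<mu> w u x + g x *o Sgn (u x)"
        using witness[of c "- c / \<mu> x / g x"] gx by simp
      moreover have "0 \<in> (h x * \<bar>u x\<bar> powr (\<alpha> - 1)) *o Sgn (u x)"
        using True by (auto simp: elt_set_times_def Sgn_def)
      ultimately show ?thesis by blast
    next
      case False
      then have pos: "u x > 0" using ux by simp
      \<comment> \<open>With \<open>u x > 0\<close>, lowering it down to 0 is admissible and yields
        the matching lower bound.\<close>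
      have left: "((\<lambda>t. \<bar>c - t\<bar>) has_real_derivative left_slope c (u x)) (at (u x) within {0..u x})" for c
        using DERIV_subset[OF abs_diff_has_left_derivative] by force
      obtain f l where f: "(f has_real_derivative l) (at (u x) within {0..u x})"
        "\<And>t. t \<in> {0..u x} \<Longrightarrow> f t \<le> f (u x)"
        "sgn l = sgn (h x * \<mu> x * u x powr (\<alpha> - 1) - (?a + g x * \<mu> x))"
        using maximiser_one_sided_derivative[OF u eu x opt left] by auto
      have "l \<ge> 0" using left_derivative_nonneg_at_max[OF f(1) pos] f(2) by auto
      then have lower: "?a \<le> \<mu> x * (?H - g x)"
        using f(3) by (auto simp: sgn_if algebra_simps split: if_splits)
      \<comment> \<open>Now \<open>s = 1\<close> is forced, and
        \<open>c = \<mu> x * (?H - g x)\<close>, which lies between both bounds, makes the witness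
        equal to \<open>?H\<close>.\<close>
      have "?H \<in> (- 1) *o one_laplacian G \<mu> w u x + g x *o Sgn (u x)"
        using witness[OF lower upper, of 1] mx pos by (simp add: Sgn_def)
      moreover have "?H \<in> (h x * \<bar>u x\<bar> powr (\<alpha> - 1)) *o Sgn (u x)"
        using pos by (simp add: elt_set_times_def Sgn_def)
      ultimately show ?thesis by blast
    qed
  qed
  then show ?thesis
    using u x\<^sub>0 by (auto simp: yamabe_solution_def)
qed

end

theorem theorem1p1:
  fixes G :: "'a pair_pre_digraph"
    and \<mu> g h :: "'a \<Rightarrow> real"
    and w :: "'a \<Rightarrow> 'a \<Rightarrow> real"
    and \<alpha> :: real
  assumes "pair_graph G"
    and "Digraph_Component.connected (with_proj G)"
    and "\<forall>x \<in> pverts G. \<mu> x > 0"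
    and "\<forall>(x, y) \<in> parcs G. w x y > 0"
    and "\<forall>(x, y) \<in> parcs G. w x y = w y x"
    and "\<alpha> > 1"
    and "\<forall>x \<in> pverts G. g x > 0"
    and "\<forall>x \<in> pverts G. h x > 0"
  shows "\<exists>u :: 'a \<Rightarrow> real.
           (\<forall>x \<in> pverts G. u x \<ge> 0) \<and>
           (\<exists>x \<in> pverts G. u x \<noteq> 0) \<and>
           yamabe_solution G \<mu> w g h \<alpha> u"
proof -
  \<comment> \<open>\<open>strongly_connected\<close> includes nonemptiness of the vertex set, and
    \<open>connected\<close> inherits it through the symmetric closure.\<close>
  have "pverts G \<noteq> {}"
    using assms(2) by (auto simp: Digraph_Component.connected_def strongly_connected_def)
  then have "weighted_yamabe_graph_axioms G \<mu> g h w \<alpha>"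
    using assms(3-) unfolding weighted_yamabe_graph_axioms_def by fast
  then interpret weighted_yamabe_graph G \<mu> g h w \<alpha>
    using assms(1) by (intro weighted_yamabe_graph.intro)
  show ?thesis
    using yamabe_solution_exists unfolding nonneg_def .
qed

end
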